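(* Let $n\ge 3$ and $k\ge 1$ be integers with $n\ge 2k$ and $k\le \frac{n-1}{2}$. Then the generalized Petersen graph $P(n,k)$ satisfies $Z_{(1)}(P(n,k))\le 2k+2$.
   Context: All graphs are finite, simple and undirected. Let $G$ be a graph, $S\subseteq V(G)$ a set of initially blue vertices (all other vertices white), and $L\subseteq V(G)$ a set of leaks. The leaky color change rule: a blue vertex $b\notin L$ which has exactly one white neighbor $w$ may force $w$ to become blue. $S$ is an $\ell$-leaky forcing set if for every choice of a set $L$ of $\ell$ leaks, repeated application of the rule eventually turns all vertices blue. $Z_{(\ell)}(G)$ is the minimum size of an $\ell$-leaky forcing set of $G$. For $n\ge 3$ and $1\le k\le \frac{n-1}{2}$, the generalized Petersen graph $P(n,k)$ has vertex set $\{x_1,\dots,x_n,y_1,\dots,y_n\}$ and edge set $\{y_iy_{i+1}:1\le i\le n\}\cup\{x_iy_i:1\le i\le n\}\cup\{x_ix_{i+k}:1\le i\le n\}$, with indices taken modulo $n$. *)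

theory Defs
  imports Complex_Main "Graph_Theory.Pair_Digraph"
begin

text \<open>
  A finite simple undirected graph is a \<^verbatim>\<open>pair_graph\<close> of the library: a finite loop-free
  digraph without parallel arcs whose arc relation is symmetric. The undirected edge \<open>uv\<close> is
  the pair of arcs \<open>(u, v)\<close> and \<open>(v, u)\<close>.
\<close>

text \<open>
  One application of the color change rule with leaks \<open>L\<close>, taking the blue set \<open>B\<close> to \<open>B'\<close>:
  some blue non-leak \<open>b\<close> has \<open>w\<close> as its only white neighbor, and \<open>w\<close> becomes blue.
\<close>

definition leaky_step :: "'a pair_pre_digraph \<Rightarrow> 'a set \<Rightarrow> 'a set \<Rightarrow> 'a set \<Rightarrow> bool" where
  "leaky_step G L B B' \<longleftrightarrow>
     (\<exists>b w. b \<in> B \<and> b \<notin> L \<and> {v. (b, v) \<in> parcs G \<and> v \<notin> B} = {w} \<and> B' = insert w B)"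

definition leaky_forcing_set :: "'a pair_pre_digraph \<Rightarrow> nat \<Rightarrow> 'a set \<Rightarrow> bool" where
  "leaky_forcing_set G l S \<longleftrightarrow> S \<subseteq> pverts G \<and>
     (\<forall>L. L \<subseteq> pverts G \<and> card L = l \<longrightarrow> (leaky_step G L)\<^sup>*\<^sup>* S (pverts G))"

definition leaky_forcing_number :: "nat \<Rightarrow> 'a pair_pre_digraph \<Rightarrow> nat" where
  "leaky_forcing_number l G = (LEAST m. \<exists>S. leaky_forcing_set G l S \<and> card S = m)"

text \<open>The minimum is attained: the full vertex set is always a leaky forcing set.\<close>

lemma leaky_forcing_set_pverts: "leaky_forcing_set G l (pverts G)"
  by (simp add: leaky_forcing_set_def)

lemma leaky_forcing_number_attained:
  "\<exists>S. leaky_forcing_set G l S \<and> card S = leaky_forcing_number l G"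
  unfolding leaky_forcing_number_def
  by (rule LeastI_ex) (use leaky_forcing_set_pverts in blast)

text \<open>
  Indices modulo \<open>n\<close> are represented by \<open>0, \<dots>, n - 1\<close>, so index \<open>0\<close> plays the role of
  index \<open>n\<close>.
\<close>

datatype petersen_vertex = X nat | Y nat

definition petersen_edges :: "nat \<Rightarrow> nat \<Rightarrow> petersen_vertex set set" where
  "petersen_edges n k =
     {{Y i, Y ((i + 1) mod n)} | i. i < n} \<union>
     {{X i, Y i} | i. i < n} \<union>
     {{X i, X ((i + k) mod n)} | i. i < n}"

definition gen_petersen :: "nat \<Rightarrow> nat \<Rightarrow> petersen_vertex pair_pre_digraph" where
  "gen_petersen n k =
     \<lparr>pverts = X ` {..<n} \<union> Y ` {..<n}, parcs = {(u, v). {u, v} \<in> petersen_edges n k}\<rparr>"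

lemma gen_petersen_pair_graph:
  assumes "n \<ge> 3" "k \<ge> 1" "2 * k + 1 \<le> n"
  shows "pair_graph (gen_petersen n k)"
proof -
  let ?G = "gen_petersen n k"
  have shift: "(i + d) mod n \<noteq> i" if "i < n" "1 \<le> d" "d < n" for i d
    using that by (cases "i + d < n") (auto simp: mod_if)
  have verts: "u \<in> pverts ?G \<and> v \<in> pverts ?G" if "(u, v) \<in> parcs ?G" for u v
    using that assms by (auto simp: gen_petersen_def petersen_edges_def doubleton_eq_iff)
  have loop: "u \<noteq> v" if "(u, v) \<in> parcs ?G" for u v
  proof
    assume "u = v"
    then have "(\<exists>i<n. (i + 1) mod n = i) \<or> (\<exists>i<n. (i + k) mod n = i)"
      using that by (auto simp: gen_petersen_def petersen_edges_def doubleton_eq_iff)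
    then show False
      using shift[of _ 1] shift[of _ k] assms by auto
  qed
  have fin: "finite (pverts ?G)"
    by (simp add: gen_petersen_def)
  have "parcs ?G \<subseteq> pverts ?G \<times> pverts ?G"
    using verts by auto
  then have "finite (parcs ?G)"
    using fin by (meson finite_SigmaI finite_subset)
  moreover have "symmetric ?G"
    by (auto simp: symmetric_def sym_def gen_petersen_def insert_commute)
  ultimately show ?thesis
    using verts loop fin by unfold_locales auto
qed

end

theory Submission
  imports Defs
begin

text \<open>
  Index the vertices by integers modulo \<open>n\<close>. The witness is the set consisting of \<open>y\<^sub>0\<close>, \<open>y\<^sub>1\<close>
  and the \<open>2k\<close> consecutive inner vertices \<open>x\<^sub>i\<close> with \<open>-k < i \<le> k\<close>; it is invariant under the
  reflection \<open>i \<mapsto> 1 - i\<close> of the graph.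

  Blue sweeps to the right from this set: once the outer vertices at \<open>0, \<dots>, m\<close> and the inner
  vertices at \<open>1 - k, \<dots>, m + k - 1\<close> are blue, the vertex \<open>y\<^sub>m\<close> can only have \<open>y\<^bsub>m+1\<^esub>\<close> as a white
  neighbor, and \<open>x\<^sub>m\<close> can only have \<open>x\<^bsub>m+k\<^esub>\<close>. Both forces at index \<open>m\<close> are made by vertices of
  index \<open>m\<close>, so a leak of index \<open>p \<in> {1, \<dots>, n}\<close> does not disturb the sweep before \<open>m = p\<close>
  (\<open>right_sweep\<close>). By reflection blue also sweeps to the left, undisturbed until it reaches the
  same leak from the other side, at index \<open>p - n\<close>. Together the two sweeps have colored the outer
  vertices at \<open>p - n, \<dots>, p\<close> and the inner vertices at \<open>p - n - k + 1, \<dots>, p + k - 1\<close>, and each of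
  these ranges contains a full period. One leak can therefore not protect any vertex: the sweeps
  need not get past it, since they meet there.

  The order in which forces happen need not be tracked: at a blue set where no force is possible,
  a blue vertex without a leak whose neighbors other than \<open>w\<close> are blue must have \<open>w\<close> blue too, so
  such a set is closed under every force of the sweeps, and it suffices that a set of this kind
  containing the witness is everything (\<open>forces_all_if_stalled_all\<close>, \<open>stalled_petersen_all\<close>).
\<close>

section \<open>Stalled blue sets\<close>

lemma stalled_last_neighbor_blue:
  assumes stalled: "\<nexists>B'. leaky_step G L B B'"
    and "b \<in> B" "b \<notin> L" "(b, w) \<in> parcs G"
    and others: "\<And>v. (b, v) \<in> parcs G \<Longrightarrow> v \<noteq> w \<Longrightarrow> v \<in> B"
  shows "w \<in> B"
proof (rule ccontr)
  assume "w \<notin> B"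
  then have "{v. (b, v) \<in> parcs G \<and> v \<notin> B} = {w}"
    using assms(4) others by auto
  then show False
    using stalled assms(2,3) unfolding leaky_step_def by blast
qed

text \<open>
  Every step colors a new vertex of the finite graph, so the process can be continued until it
  stalls. This turns reachability into a closure argument about a single set \<open>B\<close>.
\<close>

lemma forces_all_if_stalled_all:
  assumes "pair_fin_digraph G" and "S \<subseteq> pverts G"
    and all: "\<And>B. S \<subseteq> B \<Longrightarrow> B \<subseteq> pverts G \<Longrightarrow> \<nexists>B'. leaky_step G L B B' \<Longrightarrow> B = pverts G"
  shows "(leaky_step G L)\<^sup>*\<^sup>* S (pverts G)"
proof -
  interpret pair_fin_digraph G by fact
  have "(leaky_step G L)\<^sup>*\<^sup>* B (pverts G)" if "S \<subseteq> B" "B \<subseteq> pverts G" for B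
    using that
  proof (induction "card (pverts G - B)" arbitrary: B rule: less_induct)
    case less
    show ?case
    proof (cases "\<exists>B'. leaky_step G L B B'")
      case True
      then obtain b w where bw: "leaky_step G L B (insert w B)" "(b, w) \<in> parcs G" "w \<notin> B"
        unfolding leaky_step_def by blast
      then have w: "w \<in> pverts G"
        using in_arcsD2 by blast
      then have "card (pverts G - insert w B) < card (pverts G - B)"
        using bw(3) by (intro psubset_card_mono) auto
      then have "(leaky_step G L)\<^sup>*\<^sup>* (insert w B) (pverts G)"
        using less w by auto
      then show ?thesis
        using bw(1) by (rule converse_rtranclp_into_rtranclp[rotated])
    next
      case False
      then show ?thesis
        using all less.prems by auto
    qed
  qed
  then show ?thesis
    using assms(2) by blast
qed

lemma leaky_forcing_number_le:
  "leaky_forcing_set G l S \<Longrightarrow> leaky_forcing_number l G \<le> card S"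
  unfolding leaky_forcing_number_def by (rule Least_le) blast

section \<open>The generalized Petersen graph with integer indices\<close>

definition inner :: "nat \<Rightarrow> int \<Rightarrow> petersen_vertex" where
  "inner n i = X (nat (i mod int n))"

definition outer :: "nat \<Rightarrow> int \<Rightarrow> petersen_vertex" where
  "outer n i = Y (nat (i mod int n))"

context
  fixes n :: nat
  assumes n_pos: "n > 0"
begin

lemma inner_eq_iff: "inner n i = inner n j \<longleftrightarrow> i mod int n = j mod int n"
  and outer_eq_iff: "outer n i = outer n j \<longleftrightarrow> i mod int n = j mod int n"
  using n_pos by (simp_all add: inner_def outer_def eq_nat_nat_iff)

lemma inner_of_nat: "inner n (int a) = X (a mod n)"
  and outer_of_nat: "outer n (int a) = Y (a mod n)"
  by (simp_all add: inner_def outer_def nat_mod_distrib)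

lemma inner_neq_outer: "inner n i \<noteq> outer n j" "outer n j \<noteq> inner n i"
  by (simp_all add: inner_def outer_def)

lemma inner_shift: "inner n i = inner n j \<Longrightarrow> inner n (i + d) = inner n (j + d)"
  and outer_shift: "outer n i = outer n j \<Longrightarrow> outer n (i + d) = outer n (j + d)"
  by (auto simp: inner_eq_iff outer_eq_iff intro: mod_add_cong)

lemma inner_eq_iff_outer_eq: "inner n i = inner n j \<longleftrightarrow> outer n i = outer n j"
  by (simp add: inner_eq_iff outer_eq_iff)

lemma index_below_period: "\<exists>a<n. i mod int n = int a mod int n"
  using n_pos by (intro exI[of _ "nat (i mod int n)"]) (simp add: nat_less_iff)

lemma ex_index_iff:
  assumes "\<And>i j. i mod int n = j mod int n \<Longrightarrow> P i = P j"
  shows "(\<exists>a<n. P (int a)) \<longleftrightarrow> (\<exists>i. P i)"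
  using assms index_below_period by metis

lemma petersen_arc_iff:
  "(u, v) \<in> parcs (gen_petersen n k) \<longleftrightarrow>
     (\<exists>i. {u, v} = {outer n i, outer n (i + 1)} \<or> {u, v} = {inner n i, outer n i} \<or>
          {u, v} = {inner n i, inner n (i + int k)})" (is "_ \<longleftrightarrow> (\<exists>i. ?P i)")
proof -
  have "(u, v) \<in> parcs (gen_petersen n k) \<longleftrightarrow>
      (\<exists>a<n. {u, v} = {Y a, Y ((a + 1) mod n)} \<or> {u, v} = {X a, Y a} \<or>
        {u, v} = {X a, X ((a + k) mod n)})"
    unfolding gen_petersen_def petersen_edges_def pair_pre_digraph.simps mem_Collect_eq
      prod.case Un_iff by blast
  also have "\<dots> \<longleftrightarrow> (\<exists>a<n. ?P (int a))"
  proof (intro ex_cong1 conj_cong refl)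
    fix a assume "a < n"
    then show "({u, v} = {Y a, Y ((a + 1) mod n)} \<or> {u, v} = {X a, Y a} \<or>
        {u, v} = {X a, X ((a + k) mod n)}) \<longleftrightarrow> ?P (int a)"
      using inner_of_nat[of a] outer_of_nat[of a] inner_of_nat[of "a + k"]
        outer_of_nat[of "a + 1"] by (simp add: add.commute)
  qed
  also have "\<dots> \<longleftrightarrow> (\<exists>i. ?P i)"
  proof (rule ex_index_iff)
    fix i j assume "i mod int n = j mod int n"
    then have "inner n i = inner n j" "outer n i = outer n j"
      by (simp_all add: inner_eq_iff outer_eq_iff)
    moreover from this have "outer n (i + 1) = outer n (j + 1)"
      "inner n (i + int k) = inner n (j + int k)"
      by (auto intro: inner_shift outer_shift)
    ultimately show "?P i = ?P j"
      by (simp only:)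
  qed
  finally show ?thesis .
qed

lemma outer_arc_iff:
  "(outer n i, v) \<in> parcs (gen_petersen n k) \<longleftrightarrow>
     v = inner n i \<or> v = outer n (i + 1) \<or> v = outer n (i - 1)"
proof
  assume "(outer n i, v) \<in> parcs (gen_petersen n k)"
  then obtain j where
    "outer n i = outer n j \<and> v = outer n (j + 1) \<or> outer n i = outer n (j + 1) \<and> v = outer n j
      \<or> outer n i = outer n j \<and> v = inner n j"
    by (auto simp: petersen_arc_iff doubleton_eq_iff inner_neq_outer)
  then show "v = inner n i \<or> v = outer n (i + 1) \<or> v = outer n (i - 1)"
    using outer_shift[of i j 1] outer_shift[of i "j + 1" "-1"] inner_eq_iff_outer_eq[of i j] by auto
next
  assume "v = inner n i \<or> v = outer n (i + 1) \<or> v = outer n (i - 1)"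
  moreover have "{outer n i, outer n (i - 1)} = {outer n (i - 1), outer n (i - 1 + 1)}"
    by auto
  ultimately show "(outer n i, v) \<in> parcs (gen_petersen n k)"
    unfolding petersen_arc_iff by (metis insert_commute)
qed

lemma inner_arc_iff:
  "(inner n i, v) \<in> parcs (gen_petersen n k) \<longleftrightarrow>
     v = outer n i \<or> v = inner n (i + int k) \<or> v = inner n (i - int k)"
proof
  assume "(inner n i, v) \<in> parcs (gen_petersen n k)"
  then obtain j where
    "inner n i = inner n j \<and> v = inner n (j + int k)
      \<or> inner n i = inner n (j + int k) \<and> v = inner n j
      \<or> inner n i = inner n j \<and> v = outer n j"
    by (auto simp: petersen_arc_iff doubleton_eq_iff inner_neq_outer)
  then show "v = outer n i \<or> v = inner n (i + int k) \<or> v = inner n (i - int k)"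
    using inner_shift[of i j "int k"] inner_shift[of i "j + int k" "- int k"]
      inner_eq_iff_outer_eq[of i j] by auto
next
  assume "v = outer n i \<or> v = inner n (i + int k) \<or> v = inner n (i - int k)"
  moreover have "{inner n i, inner n (i - int k)} =
      {inner n (i - int k), inner n (i - int k + int k)}"
    by auto
  ultimately show "(inner n i, v) \<in> parcs (gen_petersen n k)"
    unfolding petersen_arc_iff by (metis insert_commute)
qed

text \<open>
  Any \<open>n\<close> consecutive integers represent all indices. The sweeps produce a colored interval whose
  position depends on the leak, hence the arbitrary left end \<open>a\<close>.
\<close>

lemma index_in_interval:
  obtains j where "a < j" "j \<le> a + int n" "inner n j = inner n i" "outer n j = outer n i"
proof -
  define j where "j = a + 1 + (i - a - 1) mod int n"
  have "0 \<le> (i - a - 1) mod int n" "(i - a - 1) mod int n < int n"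
    using n_pos by simp_all
  then have "a < j" "j \<le> a + int n"
    unfolding j_def by linarith+
  moreover have "j mod int n = i mod int n"
    unfolding j_def by (simp add: mod_add_right_eq)
  ultimately show thesis
    using that by (simp add: inner_eq_iff outer_eq_iff)
qed

lemma pverts_gen_petersen: "pverts (gen_petersen n k) = range (inner n) \<union> range (outer n)"
proof -
  have "X a \<in> range (inner n)" "Y a \<in> range (outer n)" if "a < n" for a
    using that inner_of_nat[of a] outer_of_nat[of a]
    by (metis mod_less rangeI)+
  then show ?thesis
    using n_pos by (auto simp: gen_petersen_def inner_def outer_def nat_less_iff)
qed

end

section \<open>The sweeps\<close>

text \<open>
  Here \<open>P\<close> and \<open>Q\<close> tell which inner and outer vertices are blue, and \<open>m\<close> is the index of the leak.
  A force at index \<open>i\<close> uses the inner vertices \<open>i - k\<close> and \<open>i\<close> and the outer vertices \<open>i - 1\<close> and \<open>i\<close>,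
  all of which lie in the ranges already colored when \<open>0 < i\<close>. Since the lemma is about predicates on
  the integers, the substitution \<open>i \<mapsto> 1 - i\<close> turns it into the left sweep.
\<close>

lemma right_sweep:
  fixes P Q :: "int \<Rightarrow> bool" and k m :: int
  assumes start: "\<And>i. - k < i \<Longrightarrow> i \<le> k \<Longrightarrow> P i" "Q 0" "Q 1"
    and outer_force: "\<And>i. 0 < i \<Longrightarrow> i < m \<Longrightarrow> Q (i - 1) \<Longrightarrow> P i \<Longrightarrow> Q i \<Longrightarrow> Q (i + 1)"
    and inner_force: "\<And>i. 0 < i \<Longrightarrow> i < m \<Longrightarrow> P (i - k) \<Longrightarrow> Q i \<Longrightarrow> P i \<Longrightarrow> P (i + k)"
    and "m \<ge> 1" "k \<ge> 1"
  shows "0 \<le> i \<Longrightarrow> i \<le> m \<Longrightarrow> Q i" and "- k < i \<Longrightarrow> i < m + k \<Longrightarrow> P i"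
proof -
  from \<open>m \<ge> 1\<close> outer_force inner_force
  have "(\<forall>i. 0 \<le> i \<longrightarrow> i \<le> m \<longrightarrow> Q i) \<and> (\<forall>i. - k < i \<longrightarrow> i < m + k \<longrightarrow> P i)"
  proof (induction m rule: int_ge_induct)
    case base
    have "i = 0 \<or> i = 1" if "0 \<le> i" "i \<le> 1" for i :: int
      using that by linarith
    then show ?case
      using start by auto
  next
    case (step m)
    have IH: "(\<forall>i. 0 \<le> i \<longrightarrow> i \<le> m \<longrightarrow> Q i) \<and> (\<forall>i. - k < i \<longrightarrow> i < m + k \<longrightarrow> P i)"
      by (rule step.IH) (use step.prems in auto)
    then have Q: "Q i" if "0 \<le> i" "i \<le> m" for i
      using that by auto
    from IH have P: "P i" if "- k < i" "i < m + k" for i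
      using that by auto
    have Q_next: "Q (m + 1)"
      using step.hyps \<open>k \<ge> 1\<close> by (intro step.prems(1) Q P) auto
    have P_next: "P (m + k)"
      using step.hyps \<open>k \<ge> 1\<close> by (intro step.prems(2) Q P) auto
    have "Q i" if "0 \<le> i" "i \<le> m + 1" for i
      using that Q Q_next by (cases "i = m + 1") auto
    moreover have "P i" if "- k < i" "i < m + 1 + k" for i
      using that P P_next by (cases "i = m + k") auto
    ultimately show ?case
      by blast
  qed
  then show "0 \<le> i \<Longrightarrow> i \<le> m \<Longrightarrow> Q i" and "- k < i \<Longrightarrow> i < m + k \<Longrightarrow> P i"
    by auto
qed

definition sweep_start :: "nat \<Rightarrow> nat \<Rightarrow> petersen_vertex set" where
  "sweep_start n k = inner n ` {- int k<..int k} \<union> {outer n 0, outer n 1}"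

lemma card_sweep_start: "card (sweep_start n k) \<le> 2 * k + 2"
proof -
  have "card (inner n ` {- int k<..int k}) \<le> 2 * k"
    using card_image_le[of "{- int k<..int k}" "inner n"] by simp
  moreover have "card {outer n 0, outer n 1} \<le> 2"
    by (simp add: card_insert_if)
  ultimately show ?thesis
    unfolding sweep_start_def using card_Un_le order_trans add_mono by (meson)
qed

text \<open>
  The leak \<open>l\<close> has one index \<open>p\<close> in \<open>{1, \<dots>, n}\<close>, and whether it is an inner or an outer vertex makes
  no difference. Unrolled along the integers it recurs at \<open>p - n\<close>. Since \<open>p - n \<le> 0\<close> and \<open>1 \<le> p\<close>,
  the sweeps that start at \<open>0\<close> and \<open>1\<close> fill everything from one copy of the leak to the next.
\<close>

lemma stalled_petersen_all:
  assumes n: "n > 0" and k: "k \<ge> 1"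
    and start: "sweep_start n k \<subseteq> B" and "B \<subseteq> pverts (gen_petersen n k)"
    and stalled: "\<nexists>B'. leaky_step (gen_petersen n k) {l} B B'"
    and leak: "l \<in> pverts (gen_petersen n k)"
  shows "B = pverts (gen_petersen n k)"
proof -
  define P where "P i \<longleftrightarrow> inner n i \<in> B" for i
  define Q where "Q i \<longleftrightarrow> outer n i \<in> B" for i
  obtain p where p: "0 < p" "p \<le> int n" and l: "l = inner n p \<or> l = outer n p"
    using leak index_in_interval[OF n, of 0] unfolding pverts_gen_petersen[OF n]
    by (smt (verit) UnE add_0 imageE)
  have no_leak: "inner n i \<notin> {l}" "outer n i \<notin> {l}" if "p - int n < i" "i < p" for i
  proof -
    have "i mod int n \<noteq> p mod int n"
    proof
      assume "i mod int n = p mod int n"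
      then have "int n dvd p - i"
        by (metis mod_eq_dvd_iff)
      then show False
        using that zdvd_imp_le[of "int n" "p - i"] by linarith
    qed
    then show "inner n i \<notin> {l}" "outer n i \<notin> {l}"
      using l by (auto simp: inner_eq_iff[OF n] outer_eq_iff[OF n] inner_neq_outer[OF n])
  qed
  have x_right: "P (i + int k)" if "p - int n < i" "i < p" "P (i - int k)" "Q i" "P i" for i
    using stalled_last_neighbor_blue[OF stalled, of "inner n i" "inner n (i + int k)"] no_leak that
    unfolding P_def Q_def inner_arc_iff[OF n] by blast
  have x_left: "P (i - int k)" if "p - int n < i" "i < p" "P (i + int k)" "Q i" "P i" for i
    using stalled_last_neighbor_blue[OF stalled, of "inner n i" "inner n (i - int k)"] no_leak that
    unfolding P_def Q_def inner_arc_iff[OF n] by blast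
  have y_right: "Q (i + 1)" if "p - int n < i" "i < p" "Q (i - 1)" "P i" "Q i" for i
    using stalled_last_neighbor_blue[OF stalled, of "outer n i" "outer n (i + 1)"] no_leak that
    unfolding P_def Q_def outer_arc_iff[OF n] by blast
  have y_left: "Q (i - 1)" if "p - int n < i" "i < p" "Q (i + 1)" "P i" "Q i" for i
    using stalled_last_neighbor_blue[OF stalled, of "outer n i" "outer n (i - 1)"] no_leak that
    unfolding P_def Q_def outer_arc_iff[OF n] by blast
  have P0: "P i" if "- int k < i" "i \<le> int k" for i
    using start that unfolding sweep_start_def P_def by auto
  have Q0: "Q 0" "Q 1"
    using start unfolding sweep_start_def Q_def by auto
  have R: "0 \<le> i \<Longrightarrow> i \<le> p \<Longrightarrow> Q i" "- int k < i \<Longrightarrow> i < p + int k \<Longrightarrow> P i" for i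
    using right_sweep[of "int k" P Q p i] P0 Q0 x_right y_right p k by auto
  \<comment> \<open>The reflection takes the leak index \<open>p - n\<close> to \<open>n + 1 - p\<close>.\<close>
  define m where "m = int n + 1 - p"
  have L: "0 \<le> i \<Longrightarrow> i \<le> m \<Longrightarrow> Q (1 - i)" "- int k < i \<Longrightarrow> i < m + int k \<Longrightarrow> P (1 - i)" for i
  proof -
    have "Q (1 - (i + 1))" if "0 < i" "i < m" "Q (1 - (i - 1))" "P (1 - i)" "Q (1 - i)" for i
      using y_left[of "1 - i"] that p by (simp add: m_def algebra_simps)
    moreover have "P (1 - (i + int k))"
      if "0 < i" "i < m" "P (1 - (i - int k))" "Q (1 - i)" "P (1 - i)" for i
      using x_left[of "1 - i"] that p by (simp add: m_def algebra_simps)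
    ultimately show "0 \<le> i \<Longrightarrow> i \<le> m \<Longrightarrow> Q (1 - i)"
      "- int k < i \<Longrightarrow> i < m + int k \<Longrightarrow> P (1 - i)"
      using right_sweep[of "int k" "\<lambda>i. P (1 - i)" "\<lambda>i. Q (1 - i)" m i] P0 Q0 p k
      by (auto simp: m_def)
  qed
  have blue: "Q i" "P i" if "p - int n < i" "i \<le> p" for i
    using that R[of i] L[of "1 - i"] k by (cases "0 < i"; force simp: m_def)+
  have "inner n i \<in> B" "outer n i \<in> B" for i
    using index_in_interval[OF n, of "p - int n" i] blue unfolding P_def Q_def
    by (metis diff_add_cancel)+
  then show ?thesis
    using assms(4) unfolding pverts_gen_petersen[OF n] by blast
qed

theorem theorem4p7:
  fixes n k :: nat
  assumes "n \<ge> 3" and "k \<ge> 1" and "n \<ge> 2 * k" and "real k \<le> (real n - 1) / 2"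
  shows "leaky_forcing_number 1 (gen_petersen n k) \<le> 2 * k + 2"
proof -
  let ?G = "gen_petersen n k"
  have n: "n > 0"
    using assms(1) by simp
  have "real (2 * k + 1) \<le> real n"
    using assms(4) by simp
  then have "2 * k + 1 \<le> n"
    by (simp only: of_nat_le_iff)
  then interpret pair_graph ?G
    using gen_petersen_pair_graph assms by blast
  have sub: "sweep_start n k \<subseteq> pverts ?G"
    unfolding sweep_start_def pverts_gen_petersen[OF n] by auto
  have "(leaky_step ?G L)\<^sup>*\<^sup>* (sweep_start n k) (pverts ?G)"
    if "L \<subseteq> pverts ?G" "card L = 1" for L
  proof -
    from \<open>card L = 1\<close> obtain l where L: "L = {l}"
      by (rule card_1_singletonE)
    show ?thesis
      using that(1) stalled_petersen_all[OF n \<open>k \<ge> 1\<close>, of _ l] sub pair_fin_digraph_axioms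
      unfolding L by (intro forces_all_if_stalled_all) auto
  qed
  then have "leaky_forcing_set ?G 1 (sweep_start n k)"
    unfolding leaky_forcing_set_def using sub by blast
  then show ?thesis
    using leaky_forcing_number_le card_sweep_start order_trans by blast
qed

end
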